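(* For every real $k>0$ and every integer $m\ge 1$, $$\int_0^k x^m\psi_k(x)\,dx=\frac{k^m(\ln k+m\gamma)}{m+1}-\frac{k^m}{m}+m\,k^m\sum_{s=2}^\infty\frac{(-1)^{s+1}}{s(m+s)}\,\zeta(s).$$
   Context: For $k>0$ and $x>0$, the $k$-gamma function is $\Gamma_k(x)=\int_0^\infty t^{x-1}e^{-t^k/k}\,dt$, and the $k$-digamma function is $\psi_k(x)=\frac{d}{dx}\ln\Gamma_k(x)$. Here $\gamma$ is the Euler–Mascheroni constant and $\zeta$ is the Riemann zeta function. *)

theory Defs
  imports "HOL-Analysis.Analysis"
begin

definition k_Gamma :: "real \<Rightarrow> real \<Rightarrow> real" where
  "k_Gamma k x = integral {0..} (\<lambda>t. t powr (x - 1) * exp (- (t powr k) / k))"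

definition k_Digamma :: "real \<Rightarrow> real \<Rightarrow> real" where
  "k_Digamma k x = deriv (\<lambda>y. ln (k_Gamma k y)) x"

(* Valid only for s > 1: the Dirichlet series is used without analytic continuation. *)
definition zeta_real :: "real \<Rightarrow> real" where
  "zeta_real s = (\<Sum>n. 1 / real (Suc n) powr s)"

end

(* Substituting u = t^k / k gives k_Gamma k x = k^(x/k - 1) Gamma (x/k), so psi_k(x) = (ln k + psi(x/k)) / k
   and everything reduces to the integral of y^m psi(y) over [0, 1].  Integrating by parts and using
   ln Gamma(y) = ln Gamma(y + 1) - ln y, an antiderivative of y^m psi(y) is
     y^m ln Gamma(y + 1) - y^m / m - m * (integral of y^(m - 1) ln Gamma(y + 1)).
   The last integral is expanded with ln Gamma(y + 1) = -gamma y + sum_{s >= 2} (-1)^s zeta(s) y^s / s,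
   valid for 0 < y < 1; integrating term by term gains a factor 1 / (m + s), so that the resulting
   series converges uniformly on the closed interval [0, 1].  This is why one works with ln Gamma:
   integrating the expansion of y^m psi(y) directly gives a series that is only conditionally
   convergent at y = 1. *)
theory Submission
  imports Defs
begin

section \<open>Reduction of the k-gamma and k-digamma functions to \<open>Gamma\<close> and
  \<open>Digamma\<close>\<close>

lemma has_integral_Ioi_iff_Ici:
  fixes f :: "real \<Rightarrow> 'a :: banach"
  shows "(f has_integral I) {a<..} \<longleftrightarrow> (f has_integral I) {a..}"
  by (rule has_integral_spike_set_eq; rule negligible_subset[OF negligible_sing[of a]]) auto

text \<open>The substitution is made on the open half-line, which \<open>g\<close> maps bijectively
  onto itself with derivative \<open>t powr (k - 1)\<close>; the endpoint 0, a null set, is restored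
  at the end.\<close>

lemma has_integral_k_Gamma:
  fixes k x :: real
  assumes "k > 0" "x > 0"
  shows "((\<lambda>t. t powr (x - 1) * exp (- (t powr k) / k)) has_integral
           k powr (x / k - 1) * Gamma (x / k)) {0..}"
proof -
  define f where "f = (\<lambda>u::real. u powr (x / k - 1) / exp u)"
  define g where "g = (\<lambda>t::real. t powr k / k)"
  have f0: "(f has_integral Gamma (x / k)) {0<..}"
    unfolding f_def
    unfolding has_integral_Ioi_iff_Ici by (rule Gamma_integral_real) (use assms in auto)
  \<comment> \<open>The substitution rule asks for absolute integrability, which nonnegativity of
    \<open>f\<close> supplies.\<close>
  have "f absolutely_integrable_on {0<..}"
    by (rule nonnegative_absolutely_integrable_1) (use f0 in \<open>auto simp: f_def\<close>)
  moreover have img: "g ` {0<..} = {0<..}"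
  proof (intro equalityI subsetI)
    fix u :: real assume "u \<in> {0<..}"
    then have "u = g ((k * u) powr (1 / k))" "(k * u) powr (1 / k) > 0"
      using assms by (auto simp: g_def powr_powr)
    then show "u \<in> g ` {0<..}" by blast
  qed (use assms in \<open>auto simp: g_def\<close>)
  moreover have inj: "inj_on g {0<..}"
  proof (intro inj_on_inverseI)
    show "(k * g t) powr (1 / k) = t" if "t \<in> {0<..}" for t
      using assms that by (simp add: g_def powr_powr)
  qed
  moreover have "(g has_field_derivative t powr (k - 1)) (at t within {0<..})" if "t \<in> {0<..}" for t
    using that assms unfolding g_def
    by (auto intro!: derivative_eq_intros simp: field_simps)
  ultimately have "(\<lambda>t. \<bar>t powr (k - 1)\<bar> * f (g t)) absolutely_integrable_on {0<..} \<and>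
      integral {0<..} (\<lambda>t. \<bar>t powr (k - 1)\<bar> * f (g t)) = Gamma (x / k)"
    using has_absolute_integral_change_of_variables_1'[of "{0<..}" g "\<lambda>t. t powr (k - 1)" f "Gamma (x / k)"] f0
    by (simp add: integral_unique)
  then have "((\<lambda>t. \<bar>t powr (k - 1)\<bar> * f (g t)) has_integral Gamma (x / k)) {0<..}"
    using absolutely_integrable_on_def has_integral_iff by blast
  then have "((\<lambda>t. k powr (x / k - 1) * (\<bar>t powr (k - 1)\<bar> * f (g t))) has_integral
      k powr (x / k - 1) * Gamma (x / k)) {0<..}"
    by (rule has_integral_mult_right)
  moreover have "k powr (x / k - 1) * (\<bar>t powr (k - 1)\<bar> * f (g t)) =
      t powr (x - 1) * exp (- (t powr k) / k)" if "t \<in> {0<..}" for t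
  proof -
    have "t powr (k - 1) * (t powr k) powr (x / k - 1) = t powr (x - 1)"
      using assms that by (simp add: powr_powr field_simps flip: powr_add)
    moreover have "f (g t) = (t powr k) powr (x / k - 1) / k powr (x / k - 1) * exp (- (t powr k) / k)"
      using assms by (simp add: f_def g_def powr_divide exp_minus inverse_eq_divide)
    ultimately show ?thesis
      using assms by simp
  qed
  ultimately have "((\<lambda>t. t powr (x - 1) * exp (- (t powr k) / k)) has_integral
      k powr (x / k - 1) * Gamma (x / k)) {0<..}"
    by (rule has_integral_eq[rotated])
  then show ?thesis
    by (simp only: has_integral_Ioi_iff_Ici)
qed

lemma k_Digamma_eq:
  fixes k x :: real
  assumes "k > 0" "x > 0"
  shows "k_Digamma k x = ln k / k + Digamma (x / k) / k"
proof -
  have "ln (k_Gamma k y) = (y / k - 1) * ln k + ln_Gamma (y / k)" if "y > 0" for y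
  proof -
    have "k_Gamma k y = k powr (y / k - 1) * Gamma (y / k)"
      unfolding k_Gamma_def by (rule integral_unique[OF has_integral_k_Gamma[OF assms(1) that]])
    moreover have "Gamma (y / k) \<noteq> 0"
      using assms that by (intro less_imp_neq[symmetric] Gamma_real_pos) auto
    ultimately show ?thesis
      using assms that by (simp add: ln_mult ln_Gamma_real_pos)
  qed
  \<comment> \<open>To differentiate, the closed form must hold on a whole neighbourhood of
    \<open>x\<close>; the positive half-line is one.\<close>
  then have ev: "\<forall>\<^sub>F y in nhds x. ln (k_Gamma k y) = (y / k - 1) * ln k + ln_Gamma (y / k)"
    using eventually_nhds_in_open[of "{0<..}" x] assms by (auto elim: eventually_mono)
  have "((\<lambda>y. (y / k - 1) * ln k + ln_Gamma (y / k)) has_field_derivative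
      (ln k / k + Digamma (x / k) / k)) (at x)"
    using assms by (auto intro!: derivative_eq_intros)
  then have "((\<lambda>y. ln (k_Gamma k y)) has_field_derivative (ln k / k + Digamma (x / k) / k)) (at x)"
    by (subst DERIV_cong_ev[OF refl ev refl])
  then show ?thesis
    unfolding k_Digamma_def by (rule DERIV_imp_deriv)
qed

section \<open>Zeta at the integers s >= 2, indexed as s = i + 2\<close>

lemma zeta_real_sums:
  "(\<lambda>n. 1 / real (Suc n) ^ (i + 2)) sums zeta_real (real (i + 2))"
proof -
  have "summable (\<lambda>n. inverse (real (Suc n) ^ (i + 2)))"
    using inverse_power_summable[of "i + 2", where 'a = real] by (subst summable_Suc_iff) auto
  moreover have "1 / real (Suc n) powr real (i + 2) = 1 / real (Suc n) ^ (i + 2)" for n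
    by (subst powr_realpow) auto
  ultimately show ?thesis
    unfolding zeta_real_def by (simp only: summable_sums inverse_eq_divide)
qed

lemma zeta_real_2_sums: "(\<lambda>n. 1 / real (Suc n) ^ 2) sums zeta_real 2"
  using zeta_real_sums[of 0] by (simp only: add_0 of_nat_numeral)

lemma zeta_real_nonneg: "zeta_real (real (i + 2)) \<ge> 0"
  by (rule sums_le[OF _ sums_zero zeta_real_sums]) auto

text \<open>Each term decreases as the exponent grows. The bound is uniform in \<open>i\<close> and
  feeds the majorants further down.\<close>

lemma zeta_real_le: "zeta_real (real (i + 2)) \<le> zeta_real 2"
  by (rule sums_le[OF _ zeta_real_sums zeta_real_2_sums])
     (intro divide_left_mono power_increasing, auto)

section \<open>Power series of ln Gamma(y + 1) on the open unit interval\<close>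

lemma ln_remainder_sums:
  fixes x :: real
  assumes "\<bar>x\<bar> < 1"
  shows "(\<lambda>i. (- 1) ^ i * x ^ (i + 2) / real (i + 2)) sums (x - ln (1 + x))"
proof -
  \<comment> \<open>The two terms split off are 0 at n = 0, because division by 0 gives 0, and
    \<open>x\<close> at n = 1.\<close>
  have "(\<lambda>n. - ((-x) ^ (n + 2)) / real (n + 2)) sums (ln (1 + x) - (\<Sum>n<2. - ((-x) ^ n) / real n))"
    by (rule sums_split_initial_segment[OF ln_series'[OF assms]])
  then have "(\<lambda>n. - ((-x) ^ (n + 2)) / real (n + 2)) sums (ln (1 + x) - x)"
    by (simp add: numeral_2_eq_2)
  from sums_minus[OF this] show ?thesis
    by (simp add: power_minus[of x] mult_ac)
qed

text \<open>Logarithm of the Weierstrass product for Gamma. It descends from the complex version,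
  since for \<open>x > 0\<close> every logarithm involved is that of a positive real.\<close>

lemma ln_Gamma_real_sums:
  fixes x :: real
  assumes "x > 0"
  shows "(\<lambda>n. x / real (Suc n) - ln (1 + x / real (Suc n))) sums
           (ln_Gamma x + euler_mascheroni * x + ln x)"
proof -
  have "complex_of_real x \<notin> \<int>\<^sub>\<le>\<^sub>0"
    using assms by (auto elim!: nonpos_Ints_cases dest!: arg_cong[of _ _ Re])
  note ln_Gamma_series'_aux[OF this]
  moreover have "complex_of_real x / of_nat (Suc n) - ln (1 + complex_of_real x / of_nat (Suc n)) =
      of_real (x / real (Suc n) - ln (1 + x / real (Suc n)))" for n
  proof -
    have "1 + x / real (Suc n) > 0" using assms by (auto intro!: add_pos_pos)
    then show ?thesis
      by (simp del: of_nat_Suc flip: Ln_of_real)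
  qed
  moreover have "ln_Gamma (complex_of_real x) + euler_mascheroni * complex_of_real x + ln (complex_of_real x)
      = of_real (ln_Gamma x + euler_mascheroni * x + ln x)"
    using assms by (simp add: ln_Gamma_complex_of_real Ln_of_real)
  ultimately show ?thesis
    by (simp only: sums_of_real_iff)
qed

text \<open>Lets the value of an unordered sum be read off from the ordinary series, by uniqueness
  of limits.\<close>

lemma summable_on_sums_imp_has_sum:
  fixes f :: "nat \<Rightarrow> 'a :: {comm_monoid_add, t2_space}"
  assumes "f summable_on UNIV" "f sums s"
  shows "(f has_sum s) UNIV"
  using assms has_sum_imp_sums has_sum_infsum sums_unique2 by metis

text \<open>Every logarithm in the Weierstrass series is expanded in powers of y / (n + 1). Summing
  the double family \<open>F\<close> over i first gives back that series, summing over n first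
  produces the zeta values, and absolute summability equates the two.\<close>

lemma ln_Gamma_plus1_sums:
  fixes y :: real
  assumes "0 < y" "y < 1"
  shows "(\<lambda>i. (- 1) ^ i * zeta_real (real (i + 2)) / real (i + 2) * y ^ (i + 2)) sums
           (ln_Gamma (y + 1) + euler_mascheroni * y)"
proof -
  define F where "F = (\<lambda>(n, i). (- 1) ^ i * (y / real (Suc n)) ^ (i + 2) / real (i + 2))"
  \<comment> \<open>Majorant of \<open>F\<close>: two of the i + 2 factors 1 / (n + 1) make the sum
    over n converge, and \<open>y ^ i\<close> with \<open>y < 1\<close> the sum over i.\<close>
  define G where "G = (\<lambda>(n, i). 1 / real (Suc n) ^ 2 * y ^ i)"
  have "((\<lambda>i. y ^ i) has_sum (1 / (1 - y))) UNIV"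
    using assms by (intro sums_nonneg_imp_has_sum geometric_sums) auto
  then have G_inner: "((\<lambda>i. G (n, i)) has_sum (1 / real (Suc n) ^ 2 * (1 / (1 - y)))) UNIV" for n
    unfolding G_def prod.case by (rule has_sum_cmult_right)
  have "(\<lambda>n. 1 / real (Suc n) ^ 2) summable_on UNIV"
    using sums_nonneg_imp_has_sum[OF zeta_real_2_sums] by (auto simp: summable_on_def)
  then have "G summable_on UNIV \<times> UNIV"
    by (intro summable_on_SigmaI[OF G_inner] summable_on_cmult_left) (use assms in \<open>auto simp: G_def\<close>)
  moreover have "norm (F p) \<le> G p" for p
  proof (cases p)
    case (Pair n i)
    have "norm (F p) = (y / real (Suc n)) ^ (i + 2) / real (i + 2)"
      using assms by (simp add: F_def Pair abs_mult power_abs del: of_nat_Suc)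
    also have "\<dots> \<le> (y / real (Suc n)) ^ (i + 2)"
      using assms by (simp add: field_simps del: of_nat_Suc)
    also have "\<dots> = y ^ (i + 2) / (real (Suc n) ^ 2 * real (Suc n) ^ i)"
      by (simp only: power_divide power_add times_divide_times_eq mult.commute[of "real (Suc n) ^ i"])
    also have "\<dots> \<le> y ^ i / real (Suc n) ^ 2"
    proof (intro frac_le)
      show "y ^ (i + 2) \<le> y ^ i"
        using assms by (intro power_decreasing) auto
      show "real (Suc n) ^ 2 \<le> real (Suc n) ^ 2 * real (Suc n) ^ i"
        by (rule mult_le_cancel_left1[THEN iffD2]) (auto intro!: one_le_power)
    qed (use assms in auto)
    finally show ?thesis
      by (simp add: G_def Pair)
  qed
  ultimately have "(\<lambda>p. norm (F p)) summable_on UNIV \<times> UNIV"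
    by (rule Infinite_Sum.abs_summable_on_comparison_test')
  then have F: "F summable_on UNIV \<times> UNIV"
    by (rule abs_summable_summable)
  then have F_sw: "(\<lambda>(i, n). F (n, i)) summable_on UNIV \<times> UNIV"
    by (rule summable_on_swap[THEN iffD1])
  obtain S where S: "(F has_sum S) (UNIV \<times> UNIV)"
    using F by (auto simp: summable_on_def)
  have rows: "((\<lambda>i. F (n, i)) has_sum (y / real (Suc n) - ln (1 + y / real (Suc n)))) UNIV" for n
  proof (rule summable_on_sums_imp_has_sum)
    show "(\<lambda>i. F (n, i)) summable_on UNIV"
      using summable_on_SigmaD1[of "\<lambda>n i. F (n, i)" UNIV "\<lambda>_. UNIV"] F by (simp add: case_prod_unfold)
    have "\<bar>y / real (Suc n)\<bar> < 1"
      using assms by (simp add: field_simps)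
    then show "(\<lambda>i. F (n, i)) sums (y / real (Suc n) - ln (1 + y / real (Suc n)))"
      unfolding F_def prod.case by (rule ln_remainder_sums)
  qed
  have cols: "((\<lambda>n. F (n, i)) has_sum
      ((- 1) ^ i * zeta_real (real (i + 2)) / real (i + 2) * y ^ (i + 2))) UNIV" for i
  proof (rule summable_on_sums_imp_has_sum)
    show "(\<lambda>n. F (n, i)) summable_on UNIV"
      using summable_on_SigmaD1[OF F_sw] by simp
    have "(\<lambda>n. (- 1) ^ i / real (i + 2) * y ^ (i + 2) * (1 / real (Suc n) ^ (i + 2))) sums
        ((- 1) ^ i / real (i + 2) * y ^ (i + 2) * zeta_real (real (i + 2)))"
      by (rule sums_mult[OF zeta_real_sums])
    moreover have "F (n, i) = (- 1) ^ i / real (i + 2) * y ^ (i + 2) * (1 / real (Suc n) ^ (i + 2))" for n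
      by (simp add: F_def power_divide mult_ac del: of_nat_Suc)
    ultimately show "(\<lambda>n. F (n, i)) sums
        ((- 1) ^ i * zeta_real (real (i + 2)) / real (i + 2) * y ^ (i + 2))"
      by (simp only: mult_ac times_divide_eq_left times_divide_eq_right)
  qed
  \<comment> \<open>Summation by rows. The recurrence for Gamma then absorbs \<open>ln y\<close>
    into \<open>ln_Gamma (y + 1)\<close>.\<close>
  have "S = ln_Gamma y + euler_mascheroni * y + ln y"
    using has_sum_SigmaD[OF S rows] ln_Gamma_real_sums[OF assms(1)] has_sum_imp_sums sums_unique2
    by blast
  also have "ln_Gamma y + ln y = ln_Gamma (y + 1)"
  proof -
    have "Gamma (y + 1) = y * Gamma y"
      using assms by (intro Gamma_plus1) (auto elim!: nonpos_Ints_cases)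
    moreover have "Gamma y \<noteq> 0"
      using assms by (intro less_imp_neq[symmetric] Gamma_real_pos)
    ultimately show ?thesis
      using assms by (simp add: ln_Gamma_real_pos ln_mult)
  qed
  then have "ln_Gamma y + euler_mascheroni * y + ln y = ln_Gamma (y + 1) + euler_mascheroni * y"
    by simp
  finally have "S = ln_Gamma (y + 1) + euler_mascheroni * y" .
  \<comment> \<open>Summation by columns, with the same total \<open>S\<close>.\<close>
  moreover have "((\<lambda>(i, n). F (n, i)) has_sum S) (UNIV \<times> UNIV)"
    using S has_sum_swap by blast
  from has_sum_SigmaD[OF this, unfolded prod.case, OF cols]
  have "(\<lambda>i. (- 1) ^ i * zeta_real (real (i + 2)) / real (i + 2) * y ^ (i + 2)) sums S"
    by (intro has_sum_imp_sums) auto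
  ultimately show ?thesis by simp
qed

section \<open>The series obtained by termwise integration: convergence, continuity and
  derivative\<close>

definition zeta_coeff :: "nat \<Rightarrow> nat \<Rightarrow> real" where
  "zeta_coeff m i = (- 1) ^ (i + 2 + 1) / (real (i + 2) * real (m + (i + 2))) * zeta_real (real (i + 2))"

text \<open>The zeta value is at most zeta(2) and both factors of the denominator are at least i +
  1. The summable bound also controls the terms at y = 1.\<close>

lemma abs_zeta_coeff_le:
  "\<bar>zeta_coeff m i\<bar> \<le> zeta_real 2 * (1 / real (Suc i) ^ 2)"
proof -
  have "real (Suc i) ^ 2 \<le> real (i + 2) * real (m + (i + 2))"
    unfolding power2_eq_square by (intro mult_mono) auto
  then have "zeta_real (real (i + 2)) / (real (i + 2) * real (m + (i + 2))) \<le>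
      zeta_real 2 / real (Suc i) ^ 2"
    by (intro frac_le zeta_real_le) (use zeta_real_nonneg[of 0] in auto)
  then show ?thesis
    using zeta_real_nonneg[of i]
    by (simp add: zeta_coeff_def abs_mult power_abs power2_eq_square mult.commute)
qed

lemma summable_zeta_coeff_bound:
  "summable (\<lambda>i. zeta_real 2 * (1 / real (Suc i) ^ 2))"
  by (intro summable_mult sums_summable[OF zeta_real_2_sums])

lemma summable_zeta_coeff: "summable (zeta_coeff m)"
  by (rule summable_comparison_test'[OF summable_zeta_coeff_bound, of 0])
     (use abs_zeta_coeff_le in auto)

text \<open>Weierstrass M-test. Continuity up to y = 1 is what later allows the antiderivative to be
  evaluated at that endpoint.\<close>

lemma continuous_on_zeta_coeff_series:
  "continuous_on {0..1} (\<lambda>y. \<Sum>i. zeta_coeff m i * y ^ (m + (i + 2)))"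
proof (rule uniform_limit_theorem)
  show "uniform_limit {0..1} (\<lambda>n y. \<Sum>i<n. zeta_coeff m i * y ^ (m + (i + 2)))
      (\<lambda>y. \<Sum>i. zeta_coeff m i * y ^ (m + (i + 2))) sequentially"
  proof (rule Weierstrass_m_test[OF _ summable_zeta_coeff_bound])
    fix i and y :: real assume "y \<in> {0..1}"
    then have "\<bar>zeta_coeff m i\<bar> * y ^ (m + (i + 2)) \<le> \<bar>zeta_coeff m i\<bar> * 1"
      by (intro mult_left_mono power_le_one) auto
    also have "\<dots> \<le> zeta_real 2 * (1 / real (Suc i) ^ 2)"
      using abs_zeta_coeff_le by simp
    finally show "norm (zeta_coeff m i * y ^ (m + (i + 2))) \<le>
        zeta_real 2 * (1 / real (Suc i) ^ 2)"
      using \<open>y \<in> {0..1}\<close> by (simp add: abs_mult)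
  qed
qed (auto intro!: continuous_intros always_eventually)

text \<open>Differentiating termwise removes the factor m + s from the denominator. What remains is
  dominated by a geometric series on each \<open>{0..r}\<close> with \<open>r < 1\<close>, which
  suffices in the open interval.\<close>

lemma has_field_derivative_zeta_coeff_series:
  fixes y :: real
  assumes "0 < y" "y < 1" "m \<ge> 1"
  shows "((\<lambda>y. \<Sum>i. zeta_coeff m i * y ^ (m + (i + 2))) has_field_derivative
           - (y ^ (m - 1) * (ln_Gamma (y + 1) + euler_mascheroni * y))) (at y)"
proof -
  \<comment> \<open>The midpoint of \<open>y\<close> and 1 keeps \<open>y\<close> interior to
    \<open>{0..r}\<close> and \<open>r\<close> below 1.\<close>
  define r where "r = (y + 1) / 2"
  define c where "c = (\<lambda>i. (- 1) ^ i * zeta_real (real (i + 2)) / real (i + 2))"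
  have r: "y < r" "0 < r" "r < 1" using assms by (auto simp: r_def)
  \<comment> \<open>The sign flips because \<open>c\<close> belongs to ln Gamma(y + 1), whose
    integral is subtracted in the integration by parts.\<close>
  have c_eq: "zeta_coeff m i * real (m + (i + 2)) = - c i" for i
    by (simp add: zeta_coeff_def c_def divide_simps)
  have c_le: "\<bar>c i\<bar> \<le> zeta_real 2" for i
  proof -
    have "\<bar>c i\<bar> = zeta_real (real (i + 2)) / real (i + 2)"
      using zeta_real_nonneg[of i] by (simp add: c_def abs_mult power_abs)
    also have "\<dots> \<le> zeta_real (real (i + 2)) / 1"
      by (intro divide_left_mono zeta_real_nonneg) auto
    finally show ?thesis using zeta_real_le[of i] by simp
  qed
  have "((\<lambda>y. \<Sum>i. zeta_coeff m i * y ^ (m + (i + 2))) has_field_derivative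
      (\<Sum>i. - c i * y ^ (m + (i + 2) - 1))) (at y)"
  proof (rule has_field_derivative_series'(2))
    show "convex {0..r}" "0 \<in> {0..r}" "y \<in> interior {0..r}"
      using assms r by auto
    show "((\<lambda>y. zeta_coeff m i * y ^ (m + (i + 2))) has_field_derivative
        - c i * t ^ (m + (i + 2) - 1)) (at t within {0..r})" for i t
    proof -
      have "((\<lambda>y. zeta_coeff m i * y ^ (m + (i + 2))) has_field_derivative
          zeta_coeff m i * (real (m + (i + 2)) * t ^ (m + (i + 2) - 1))) (at t within {0..r})"
        using DERIV_cmult[OF DERIV_pow[of "m + (i + 2)"], of "zeta_coeff m i" t "{0..r}"]
        by (simp only: One_nat_def)
      then show ?thesis
        unfolding mult.assoc[symmetric] c_eq .
    qed
    show "uniformly_convergent_on {0..r} (\<lambda>n t. \<Sum>i<n. - c i * t ^ (m + (i + 2) - 1))"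
    proof (rule Weierstrass_m_test')
      show "summable (\<lambda>i. zeta_real 2 * r ^ i)"
        using r by (intro summable_mult summable_geometric) auto
      fix i t assume t: "t \<in> {0..r}"
      have "t ^ (m + (i + 2) - 1) \<le> t ^ i"
        using t r by (intro power_decreasing) auto
      also have "\<dots> \<le> r ^ i"
        using t by (intro power_mono) auto
      finally have "\<bar>c i\<bar> * t ^ (m + (i + 2) - 1) \<le> zeta_real 2 * r ^ i"
        using t c_le by (intro mult_mono) (use zeta_real_nonneg[of 0] in auto)
      then show "norm (- c i * t ^ (m + (i + 2) - 1)) \<le> zeta_real 2 * r ^ i"
        using t by (simp add: abs_mult)
    qed
    \<comment> \<open>Convergence is needed at one point only; at 0 all terms vanish, the exponents
      being positive.\<close>
    show "summable (\<lambda>i. zeta_coeff m i * 0 ^ (m + (i + 2)))"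
      by simp
  qed
  moreover have "(\<lambda>i. - (y ^ (m - 1)) * (c i * y ^ (i + 2))) sums
      (- (y ^ (m - 1)) * (ln_Gamma (y + 1) + euler_mascheroni * y))"
    unfolding c_def by (intro sums_mult ln_Gamma_plus1_sums assms)
  moreover have "- (y ^ (m - 1)) * (c i * y ^ (i + 2)) = - c i * y ^ (m + (i + 2) - 1)" for i
  proof -
    have "m + (i + 2) - 1 = (m - 1) + (i + 2)" using assms by simp
    then show ?thesis by (simp only: power_add) (simp add: mult_ac)
  qed
  ultimately show ?thesis
    by (simp only: sums_iff) simp
qed

section \<open>Evaluation of the integral by an explicit antiderivative\<close>

theorem theorem3p2:
  fixes k :: real and m :: nat
  assumes "k > 0" and "m \<ge> 1"
  shows "summable (\<lambda>i. (- 1) ^ (i + 2 + 1) / (real (i + 2) * real (m + (i + 2))) * zeta_real (real (i + 2))) \<and>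
          ((\<lambda>x. x ^ m * k_Digamma k x) has_integral
           (k ^ m * (ln k + real m * euler_mascheroni) / (real m + 1) - k ^ m / real m
            + real m * k ^ m *
              (\<Sum>i. (- 1) ^ (i + 2 + 1) / (real (i + 2) * real (m + (i + 2))) * zeta_real (real (i + 2)))))
         {0..k}"
proof
  show "summable (\<lambda>i. (- 1) ^ (i + 2 + 1) / (real (i + 2) * real (m + (i + 2))) * zeta_real (real (i + 2)))"
    using summable_zeta_coeff[of m] by (simp only: zeta_coeff_def[abs_def])
next
  define P where "P = (\<lambda>y. \<Sum>i. zeta_coeff m i * y ^ (m + (i + 2)))"
  \<comment> \<open>The antiderivative of y^m psi(y), with the series inserted: \<open>P\<close>
    accounts for the terms s >= 2, and the linear term -gamma y of ln Gamma(y + 1) gives the last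
    summand.\<close>
  define H where "H = (\<lambda>y. y ^ m * ln_Gamma (y + 1) - y ^ m / real m + real m * P y
    + real m * euler_mascheroni * y ^ (m + 1) / real (m + 1))"
  \<comment> \<open>Rescaling by y = x / k; the first summand integrates the part
    \<open>ln k / k\<close> of \<open>k_Digamma\<close>.\<close>
  define A where "A = (\<lambda>x. ln k / k * x ^ (m + 1) / real (m + 1) + k ^ m * H (x / k))"
  have H': "(H has_field_derivative y ^ m * Digamma y) (at y)" if y: "0 < y" "y < 1" for y
  proof -
    \<comment> \<open>The extra 1 / y turns into y^(m - 1), which cancels against the derivative of
      y^m / m.\<close>
    have Digamma: "Digamma (y + 1) = Digamma y + 1 / y"
      using y by (intro Digamma_plus1) auto
    have DP: "(P has_field_derivative - (y ^ (m - 1) * (ln_Gamma (y + 1) + euler_mascheroni * y))) (at y)"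
      unfolding P_def by (rule has_field_derivative_zeta_coeff_series[OF y assms(2)])
    have DL: "((\<lambda>y. ln_Gamma (y + 1)) has_field_derivative Digamma (y + 1)) (at y)"
      using y by (auto intro!: derivative_eq_intros)
    obtain j where j: "m = Suc j"
      using assms by (cases m) auto
    have "(H has_field_derivative
        (y ^ m * Digamma (y + 1) + real m * y ^ (m - 1) * ln_Gamma (y + 1)) - real m * y ^ (m - 1) / real m
        + real m * - (y ^ (m - 1) * (ln_Gamma (y + 1) + euler_mascheroni * y))
        + real m * euler_mascheroni * (real (m + 1) * y ^ m) / real (m + 1)) (at y)"
      unfolding H_def
      using DERIV_pow[of m y] DERIV_pow[of "m + 1" y] DERIV_mult'[OF DERIV_pow[of m y] DL]
      by (intro DERIV_add DERIV_diff DERIV_cmult DERIV_cdivide DP) auto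
    also have "(y ^ m * Digamma (y + 1) + real m * y ^ (m - 1) * ln_Gamma (y + 1)) - real m * y ^ (m - 1) / real m
        + real m * - (y ^ (m - 1) * (ln_Gamma (y + 1) + euler_mascheroni * y))
        + real m * euler_mascheroni * (real (m + 1) * y ^ m) / real (m + 1) = y ^ m * Digamma y"
    proof -
      have "real m * y ^ (m - 1) / real m = y ^ (m - 1)"
        "real m * euler_mascheroni * (real (m + 1) * y ^ m) / real (m + 1) = real m * euler_mascheroni * y ^ m"
        using assms by auto
      then show ?thesis
        using y by (simp only: Digamma) (simp add: j algebra_simps)
    qed
    finally show ?thesis .
  qed
  have cont_P: "continuous_on {0..k} (\<lambda>x. P (x / k))"
    by (rule continuous_on_compose2[OF continuous_on_zeta_coeff_series[of m, folded P_def]])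
       (use assms in \<open>auto intro!: continuous_intros\<close>)
  \<comment> \<open>The shift by 1 keeps the argument positive even at x = 0.\<close>
  have cont_ln_Gamma: "continuous_on {0..k} (\<lambda>x. ln_Gamma (x / k + 1))"
  proof (rule continuous_at_imp_continuous_on, rule ballI)
    fix x assume "x \<in> {0..k}"
    then have "x / k + 1 > 0" using assms by (intro add_nonneg_pos) auto
    then show "isCont (\<lambda>x. ln_Gamma (x / k + 1)) x"
      using assms by (auto intro!: DERIV_isCont derivative_eq_intros)
  qed
  have "((\<lambda>x. x ^ m * k_Digamma k x) has_integral (A k - A 0)) {0..k}"
  \<comment> \<open>Continuity on the closed interval and the derivative inside suffice: psi has a
    pole at 0, and at x = k the geometric majorant is lost.\<close>
  proof (rule fundamental_theorem_of_calculus_interior)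
    show "continuous_on {0..k} A"
      unfolding A_def H_def by (intro continuous_intros cont_P cont_ln_Gamma) (use assms in auto)
    fix x assume x: "x \<in> {0<..<k}"
    have "((\<lambda>x. H (x / k)) has_field_derivative (x / k) ^ m * Digamma (x / k) * (1 / k)) (at x)"
      by (rule DERIV_chain2[OF H' DERIV_cdivide[OF DERIV_ident]]) (use assms x in auto)
    then have "(A has_field_derivative ln k / k * (real (m + 1) * x ^ m) / real (m + 1)
        + k ^ m * ((x / k) ^ m * Digamma (x / k) * (1 / k))) (at x)"
      unfolding A_def
      using DERIV_pow[of "m + 1" x] by (intro DERIV_add DERIV_cmult DERIV_cdivide) auto
    also have "ln k / k * (real (m + 1) * x ^ m) / real (m + 1) = ln k / k * x ^ m"
      by (subst mult.left_commute, rule nonzero_mult_div_cancel_left) simp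
    also have "ln k / k * x ^ m
        + k ^ m * ((x / k) ^ m * Digamma (x / k) * (1 / k)) = x ^ m * k_Digamma k x"
      using assms x by (simp add: k_Digamma_eq power_divide distrib_left)
    finally show "(A has_vector_derivative x ^ m * k_Digamma k x) (at x)"
      by (simp add: has_real_derivative_iff_has_vector_derivative)
  qed (use assms in auto)
  \<comment> \<open>Here \<open>m \<ge> 1\<close> makes the powers \<open>0 ^ m\<close>
    vanish.\<close>
  moreover have "A 0 = 0"
    using assms by (simp add: A_def H_def P_def power_0_left)
  \<comment> \<open>At x = k the argument is 1 + 1, and Gamma(2) = 1.\<close>
  moreover have "ln_Gamma (2 :: real) = 0"
    using ln_Gamma_real_conv_fact[of 2] by simp
  then have "A k = k ^ m * (ln k + real m * euler_mascheroni) / (real m + 1) - k ^ m / real m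
      + real m * k ^ m * (\<Sum>i. zeta_coeff m i)"
  proof -
    have "ln k / k * k ^ (m + 1) = k ^ m * ln k" "k / k = 1"
      using assms by auto
    with \<open>ln_Gamma 2 = 0\<close> show ?thesis
      by (simp only: A_def H_def P_def) (simp add: add_divide_distrib ring_distribs add.commute)
  qed
  ultimately show "((\<lambda>x. x ^ m * k_Digamma k x) has_integral
           (k ^ m * (ln k + real m * euler_mascheroni) / (real m + 1) - k ^ m / real m
            + real m * k ^ m *
              (\<Sum>i. (- 1) ^ (i + 2 + 1) / (real (i + 2) * real (m + (i + 2))) * zeta_real (real (i + 2)))))
         {0..k}"
    by (simp only: zeta_coeff_def diff_zero)
qed

end
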